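(* Let $P\subset \mathbb{R}^d$ be a locally anti-blocking lattice polytope with $0$ in its interior. Then $P$ is reflexive if and only if for every $\sigma \in \{-1,+1\}^d$ there is a perfect graph $G_\sigma$ on vertex set $[d]$ such that $P \cap \mathbb{R}^d_\sigma = \sigma P_{G_\sigma}$. In particular, $P$ is an unconditional reflexive polytope if and only if $P = \mathcal{U}P_G$ for some perfect graph $G$ on $[d]$.
   Context: For $\sigma\in\{-1,+1\}^d$, $\sigma\mathbf{p}=(\sigma_1p_1,\dots,\sigma_dp_d)$, $\sigma Q=\{\sigma\mathbf{p}:\mathbf{p}\in Q\}$, and $\mathbb{R}^d_\sigma=\sigma\mathbb{R}^d_+$. A polytope $Q\subset\mathbb{R}^d_+$ is anti-blocking if $\mathbf{q}\in Q$ and $0\le p_i\le q_i$ for all $i$ imply $\mathbf{p}\in Q$; $P$ is locally anti-blocking if $(\sigma P)\cap\mathbb{R}^d_+$ is anti-blocking for all $\sigma$; $P$ is unconditional if $\sigma P=P$ for all $\sigma$. For an anti-blocking $Q$, $\mathcal{U}Q=\{\mathbf{p}:(|p_1|,\dots,|p_d|)\in Q\}$. A lattice $d$-polytope with $0$ in its interior is reflexive if its polar dual is a lattice polytope. For a graph $G=([d],E)$, the stable set polytope is $P_G=\mathrm{conv}\{\mathbf{1}_S : S\subseteq[d] \text{ stable set of } G\}$, where $\mathbf{1}_S$ is the characteristic vector. $G$ is perfect if the clique number equals the chromatic number for every induced subgraph. *)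

theory Defs
  imports "HOL-Analysis.Analysis" "HOL-Library.Ramsey"
begin

text \<open>Throughout, \<open>\<real>\<^sup>d\<close> is \<open>real ^ 'n\<close> and \<open>[d]\<close> is \<open>UNIV :: 'n set\<close>, with \<open>d = CARD('n)\<close>.\<close>

definition sign_vectors :: "(real ^ 'n) set" where
  "sign_vectors = {\<sigma>. \<forall>i. \<sigma> $ i \<in> {-1, 1}}"

definition sign_act :: "real ^ 'n \<Rightarrow> real ^ 'n \<Rightarrow> real ^ 'n" where
  "sign_act \<sigma> p = (\<chi> i. \<sigma> $ i * p $ i)"

definition nonneg_orthant :: "(real ^ 'n) set" where
  "nonneg_orthant = {p. \<forall>i. 0 \<le> p $ i}"

definition signed_orthant :: "real ^ 'n \<Rightarrow> (real ^ 'n) set" where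
  "signed_orthant \<sigma> = sign_act \<sigma> ` nonneg_orthant"

definition anti_blocking :: "(real ^ 'n) set \<Rightarrow> bool" where
  "anti_blocking Q \<longleftrightarrow>
     polytope Q \<and> Q \<subseteq> nonneg_orthant \<and>
     (\<forall>q p. q \<in> Q \<and> (\<forall>i. 0 \<le> p $ i \<and> p $ i \<le> q $ i) \<longrightarrow> p \<in> Q)"

definition locally_anti_blocking :: "(real ^ 'n) set \<Rightarrow> bool" where
  "locally_anti_blocking P \<longleftrightarrow>
     polytope P \<and> (\<forall>\<sigma> \<in> sign_vectors. anti_blocking (sign_act \<sigma> ` P \<inter> nonneg_orthant))"

definition unconditional :: "(real ^ 'n) set \<Rightarrow> bool" where
  "unconditional P \<longleftrightarrow> (\<forall>\<sigma> \<in> sign_vectors. sign_act \<sigma> ` P = P)"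

definition unconditional_hull :: "(real ^ 'n) set \<Rightarrow> (real ^ 'n) set" where
  "unconditional_hull Q = {p. (\<chi> i. \<bar>p $ i\<bar>) \<in> Q}"

definition integer_lattice :: "(real ^ 'n) set" where
  "integer_lattice = {p. \<forall>i. p $ i \<in> \<int>}"

definition lattice_polytope :: "(real ^ 'n) set \<Rightarrow> bool" where
  "lattice_polytope P \<longleftrightarrow> (\<exists>V. finite V \<and> V \<subseteq> integer_lattice \<and> P = convex hull V)"

definition polar_dual :: "(real ^ 'n) set \<Rightarrow> (real ^ 'n) set" where
  "polar_dual P = {y. \<forall>x \<in> P. y \<bullet> x \<le> 1}"

text \<open>Having \<open>0\<close> in the (topological) interior forces \<open>P\<close> to be full-dimensional.\<close>

definition reflexive_polytope :: "(real ^ 'n) set \<Rightarrow> bool" where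
  "reflexive_polytope P \<longleftrightarrow>
     lattice_polytope P \<and> 0 \<in> interior P \<and> lattice_polytope (polar_dual P)"

text \<open>A graph on vertex set \<open>[d]\<close> is given by its edge set \<open>E\<close>. Cliques and stable sets are
  \<^const>\<open>clique\<close> and \<^const>\<open>indep\<close>. The subgraph induced on \<open>W\<close> has the edges \<open>e \<in> E\<close>
  with \<open>e \<subseteq> W\<close>, so its cliques and proper colourings can be read off from \<open>E\<close>.\<close>

definition simple_graph :: "'n set set \<Rightarrow> bool" where
  "simple_graph E \<longleftrightarrow> (\<forall>e \<in> E. card e = 2)"

definition clique_number :: "'n::finite set \<Rightarrow> 'n set set \<Rightarrow> nat" where
  "clique_number W E = Max {card C |C. C \<subseteq> W \<and> clique C E}"

definition proper_colouring :: "'n set \<Rightarrow> 'n set set \<Rightarrow> nat \<Rightarrow> ('n \<Rightarrow> nat) \<Rightarrow> bool" where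
  "proper_colouring W E k f \<longleftrightarrow>
     f ` W \<subseteq> {..<k} \<and> (\<forall>v \<in> W. \<forall>w \<in> W. {v, w} \<in> E \<longrightarrow> f v \<noteq> f w)"

definition chromatic_number :: "'n::finite set \<Rightarrow> 'n set set \<Rightarrow> nat" where
  "chromatic_number W E = (LEAST k. \<exists>f. proper_colouring W E k f)"

definition perfect_graph :: "'n::finite set set \<Rightarrow> bool" where
  "perfect_graph E \<longleftrightarrow>
     simple_graph E \<and> (\<forall>W. clique_number W E = chromatic_number W E)"

definition char_vec :: "'n set \<Rightarrow> real ^ 'n" where
  "char_vec S = (\<chi> i. if i \<in> S then 1 else 0)"

definition stable_set_polytope :: "'n::finite set set \<Rightarrow> (real ^ 'n) set" where
  "stable_set_polytope E = convex hull {char_vec S |S. indep S E}"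

end

theory Submission
  imports Defs
begin

text \<open>
  For a polytope closed under setting coordinates to zero, polarity works orthant by orthant: the
  polar dual meets the positive orthant in the anti-blocker \<open>A(Q)\<close> of the positive part \<open>Q\<close>, and
  \<open>A(A(Q)) = Q\<close>. If \<open>P\<close> is reflexive, then \<open>Q\<close> and \<open>A(Q)\<close> are both spanned by lattice points and
  both contain the unit vectors, so both are 0/1-polytopes; hence the 0/1-points of \<open>Q\<close> are the
  stable sets of the graph whose edges are the pairs \<open>{i, j}\<close> with \<open>e\<^sub>i + e\<^sub>j \<notin> Q\<close>, and those of
  \<open>A(Q)\<close> are cliques. The link to perfection is the theorem of Lovasz, Fulkerson and Chvatal: a
  graph is perfect iff its stable set polytope is the anti-blocker of its cliques.
\<close>

section \<open>Closure under zeroing coordinates\<close>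

definition coord_restrict :: "'n set \<Rightarrow> real ^ 'n \<Rightarrow> real ^ 'n" where
  "coord_restrict J x = (\<chi> i. if i \<in> J then x $ i else 0)"

text \<open>Common consequence of local anti-blocking and of convexity with unconditionality; it is
  inherited by polars, sign images and the positive part.\<close>

definition restriction_closed :: "(real ^ 'n) set \<Rightarrow> bool" where
  "restriction_closed P \<longleftrightarrow> (\<forall>J. \<forall>x\<in>P. coord_restrict J x \<in> P)"

text \<open>Fulkerson's anti-blocker \<open>A(Q)\<close>, defined for any set so that it applies to
  finite vertex sets as well as to their hulls.\<close>

definition anti_blocker :: "(real ^ 'n) set \<Rightarrow> (real ^ 'n) set" where
  "anti_blocker Q = {y \<in> nonneg_orthant. \<forall>x\<in>Q. y \<bullet> x \<le> 1}"

lemma coord_restrict_nth [simp]: "coord_restrict J x $ i = (if i \<in> J then x $ i else 0)"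
  by (simp add: coord_restrict_def)

lemma linear_coord_restrict: "linear (coord_restrict J)"
  by (rule linearI) (auto simp: vec_eq_iff)

lemma restriction_closedD: "restriction_closed P \<Longrightarrow> x \<in> P \<Longrightarrow> coord_restrict J x \<in> P"
  by (simp add: restriction_closed_def)

lemma restriction_closed_convex_hull:
  assumes "\<And>J w. w \<in> W \<Longrightarrow> coord_restrict J w \<in> W"
  shows "restriction_closed (convex hull W)"
  unfolding restriction_closed_def
proof (intro allI ballI)
  fix J x assume "x \<in> convex hull W"
  then have "coord_restrict J x \<in> convex hull (coord_restrict J ` W)"
    using convex_hull_linear_image[OF linear_coord_restrict] by blast
  then show "coord_restrict J x \<in> convex hull W"
    using hull_mono[of "coord_restrict J ` W" W convex] assms by blast
qed

lemma inner_coord_restrict: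
  fixes x y :: "real ^ 'n"
  shows "coord_restrict J y \<bullet> x = y \<bullet> coord_restrict J x"
  unfolding inner_vec_def by (rule sum.cong) auto

text \<open>One coordinate at a time: scaling coordinate \<open>j\<close> by \<open>t j\<close> is
  the convex combination, with weights \<open>t j\<close> and \<open>1 - t j\<close>, of the point
  and the point with coordinate \<open>j\<close> zeroed.\<close>

lemma restriction_closed_scale:
  fixes K :: "(real ^ 'n) set"
  assumes "convex K" "restriction_closed K" "q \<in> K" "\<And>i. 0 \<le> t i" "\<And>i. t i \<le> 1"
  shows "(\<chi> i. t i * q $ i) \<in> K"
proof -
  have "(\<chi> i. if i \<in> J then t i * q $ i else q $ i) \<in> K" if "finite J" for J
    using that
  proof (induction J rule: finite_induct)
    case empty
    then show ?case using assms(3) by simp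
  next
    case (insert j J)
    define u where "u = (\<chi> i. if i \<in> J then t i * q $ i else q $ i)"
    have u: "u \<in> K" using insert.IH by (simp add: u_def)
    have "t j *\<^sub>R u + (1 - t j) *\<^sub>R coord_restrict (- {j}) u \<in> K"
      using assms(4,5)[of j] u restriction_closedD[OF assms(2) u] by (intro convexD[OF assms(1)]) auto
    moreover have "t j *\<^sub>R u + (1 - t j) *\<^sub>R coord_restrict (- {j}) u
        = (\<chi> i. if i \<in> insert j J then t i * q $ i else q $ i)"
      using insert.hyps(2) by (auto simp: vec_eq_iff u_def algebra_simps)
    ultimately show ?case by simp
  qed
  from this[of UNIV] show ?thesis by simp
qed

lemma restriction_closed_down:
  fixes K :: "(real ^ 'n) set"
  assumes "convex K" "restriction_closed K" "q \<in> K" "\<And>i. 0 \<le> p $ i" "\<And>i. p $ i \<le> q $ i"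
  shows "p \<in> K"
proof -
  \<comment> \<open>Where \<open>q $ i = 0\<close>, also \<open>p $ i = 0\<close>, and the quotient
    is 0 by the convention on division.\<close>
  have "(\<chi> i. (p $ i / q $ i) * q $ i) \<in> K"
  proof (rule restriction_closed_scale[OF assms(1-3)])
    fix i
    have pq: "0 \<le> p $ i" "p $ i \<le> q $ i" using assms(4,5) by auto
    then show "0 \<le> p $ i / q $ i" by simp
    show "p $ i / q $ i \<le> 1" using pq by (cases "q $ i = 0") auto
  qed
  moreover have "(\<chi> i. (p $ i / q $ i) * q $ i) = p"
    using assms(4,5) by (auto simp: vec_eq_iff) (metis order_antisym)
  ultimately show ?thesis by simp
qed

section \<open>Anti-blocking duality\<close>

lemma convex_nonneg_orthant: "convex (nonneg_orthant :: (real ^ 'n) set)"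
  by (auto simp: convex_def nonneg_orthant_def)

lemma anti_blocker_convex_hull: "anti_blocker (convex hull V) = anti_blocker V"
proof -
  have "(\<forall>x\<in>convex hull V. y \<bullet> x \<le> 1) \<longleftrightarrow> (\<forall>x\<in>V. y \<bullet> x \<le> 1)" for y
  proof -
    have "convex {x. y \<bullet> x \<le> 1}" by (rule convex_halfspace_le)
    then have "V \<subseteq> {x. y \<bullet> x \<le> 1} \<Longrightarrow> convex hull V \<subseteq> {x. y \<bullet> x \<le> 1}"
      by (rule hull_minimal[rotated])
    then show ?thesis using hull_subset[of V convex] by blast
  qed
  then show ?thesis by (simp add: anti_blocker_def)
qed

text \<open>The bipolar theorem inside the orthant: a hyperplane separating \<open>z\<close> from
  \<open>K\<close>, suitably normalised, becomes an element of \<open>anti_blocker K\<close> that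
  excludes \<open>z\<close>.\<close>

lemma anti_blocker_anti_blocker:
  fixes K :: "(real ^ 'n) set"
  assumes "convex K" "closed K" "0 \<in> K" "K \<subseteq> nonneg_orthant" "restriction_closed K"
  shows "anti_blocker (anti_blocker K) = K"
proof
  show "K \<subseteq> anti_blocker (anti_blocker K)"
    using assms(4) by (auto simp: anti_blocker_def inner_commute)
  show "anti_blocker (anti_blocker K) \<subseteq> K"
  proof
    fix z assume z: "z \<in> anti_blocker (anti_blocker K)"
    show "z \<in> K"
    proof (rule ccontr)
      assume "z \<notin> K"
      then obtain a b where ab: "a \<bullet> z < b" "\<And>x. x \<in> K \<Longrightarrow> b < a \<bullet> x"
        using separating_hyperplane_closed_point[OF assms(1,2)] by blast
      \<comment> \<open>Only the positive part of the separating functional \<open>-a\<close> matters, because zeroing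
        coordinates does not leave \<open>K\<close>.\<close>
      define J where "J = {i. a $ i < 0}"
      define c where "c = - coord_restrict J a"
      have b: "b < 0" using ab(2)[OF assms(3)] by simp
      have zn: "\<And>i. 0 \<le> z $ i" using z by (simp add: anti_blocker_def nonneg_orthant_def)
      have "(1 / (- b)) *\<^sub>R c \<in> anti_blocker K"
        unfolding anti_blocker_def
      proof (intro CollectI conjI ballI)
        show "(1 / (- b)) *\<^sub>R c \<in> nonneg_orthant"
          using b by (auto simp: nonneg_orthant_def c_def J_def divide_nonpos_neg)
        fix x assume "x \<in> K"
        then have "b < a \<bullet> coord_restrict J x" using ab(2) restriction_closedD[OF assms(5)] by blast
        then have "c \<bullet> x < - b" by (simp add: c_def inner_coord_restrict)
        then show "((1 / (- b)) *\<^sub>R c) \<bullet> x \<le> 1" using b by (simp add: field_simps)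
      qed
      then have "z \<bullet> ((1 / (- b)) *\<^sub>R c) \<le> 1"
        using z unfolding anti_blocker_def[of "anti_blocker K"] by blast
      then have le: "c \<bullet> z \<le> - b" using b by (simp add: inner_commute field_simps)
      \<comment> \<open>As \<open>z\<close> is nonnegative, discarding the coordinates with
        \<open>a $ i \<ge> 0\<close> can only raise \<open>- (a \<bullet> z)\<close>, which already
        exceeds \<open>- b\<close>.\<close>
      have "- (a \<bullet> z) \<le> c \<bullet> z"
        unfolding inner_vec_def sum_negf[symmetric]
        using zn by (intro sum_mono) (auto simp: c_def J_def)
      then show False using le ab(1) by simp
    qed
  qed
qed

section \<open>Sign changes\<close>

lemma sign_act_nth [simp]: "sign_act \<sigma> p $ i = \<sigma> $ i * p $ i"
  by (simp add: sign_act_def)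

lemma linear_sign_act: "linear (sign_act \<sigma>)"
  by (rule linearI) (auto simp: vec_eq_iff algebra_simps)

lemma sign_vectors_square:
  assumes "\<sigma> \<in> sign_vectors"
  shows "\<sigma> $ i * \<sigma> $ i = 1"
proof -
  have "\<sigma> $ i = -1 \<or> \<sigma> $ i = 1" using assms by (auto simp: sign_vectors_def)
  then show ?thesis by auto
qed

lemma sign_act_sign_act:
  assumes "\<sigma> \<in> sign_vectors"
  shows "sign_act \<sigma> (sign_act \<sigma> p) = p"
  using sign_vectors_square[OF assms] by (simp add: vec_eq_iff mult.assoc[symmetric])

lemma sign_act_image_image:
  assumes "\<sigma> \<in> sign_vectors"
  shows "sign_act \<sigma> ` sign_act \<sigma> ` P = P"
  using sign_act_sign_act[OF assms] by (simp add: image_image)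

lemma sign_act_image_iff:
  assumes "\<sigma> \<in> sign_vectors"
  shows "x \<in> sign_act \<sigma> ` P \<longleftrightarrow> sign_act \<sigma> x \<in> P"
  using sign_act_sign_act[OF assms] by (metis image_iff)

lemma inner_sign_act: "sign_act \<sigma> x \<bullet> y = x \<bullet> sign_act \<sigma> y"
  by (simp add: inner_vec_def mult_ac)

lemma sign_act_coord_restrict: "sign_act \<sigma> (coord_restrict J x) = coord_restrict J (sign_act \<sigma> x)"
  by (simp add: vec_eq_iff)

lemma restriction_closed_sign_act:
  "restriction_closed P \<Longrightarrow> restriction_closed (sign_act \<sigma> ` P)"
  by (auto simp: restriction_closed_def sign_act_coord_restrict[symmetric])

lemma sign_act_integer:
  assumes "\<sigma> \<in> sign_vectors" "v \<in> integer_lattice"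
  shows "sign_act \<sigma> v \<in> integer_lattice"
  unfolding integer_lattice_def
proof (intro CollectI allI)
  fix i
  have "\<sigma> $ i = -1 \<or> \<sigma> $ i = 1" using assms(1) by (auto simp: sign_vectors_def)
  then show "sign_act \<sigma> v $ i \<in> \<int>" using assms(2) by (auto simp: integer_lattice_def)
qed

lemma lattice_polytope_sign_act:
  assumes "\<sigma> \<in> sign_vectors" "lattice_polytope P"
  shows "lattice_polytope (sign_act \<sigma> ` P)"
proof -
  obtain V where V: "finite V" "V \<subseteq> integer_lattice" "P = convex hull V"
    using assms(2) by (auto simp: lattice_polytope_def)
  then show ?thesis
    unfolding lattice_polytope_def
    by (intro exI[of _ "sign_act \<sigma> ` V"])
      (use sign_act_integer[OF assms(1)] in \<open>auto simp: convex_hull_linear_image[OF linear_sign_act]\<close>)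
qed

lemma polar_dual_sign_act:
  assumes "\<sigma> \<in> sign_vectors"
  shows "polar_dual (sign_act \<sigma> ` P) = sign_act \<sigma> ` polar_dual P"
  by (auto simp: polar_dual_def sign_act_image_iff[OF assms] inner_sign_act sign_act_sign_act[OF assms])

lemma lattice_polytope_convex: "lattice_polytope P \<Longrightarrow> convex P"
  by (auto simp: lattice_polytope_def convex_convex_hull)

lemma lattice_polytope_compact: "lattice_polytope P \<Longrightarrow> compact P"
  by (auto simp: lattice_polytope_def intro: finite_imp_compact_convex_hull)

lemma interior_sign_act:
  assumes "\<sigma> \<in> sign_vectors" "0 \<in> interior P"
  shows "0 \<in> interior (sign_act \<sigma> ` P)"
proof -
  have inj: "inj (sign_act \<sigma>)" using sign_act_sign_act[OF assms(1)] by (metis injI)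
  have "interior (sign_act \<sigma> ` P) = sign_act \<sigma> ` interior P"
    using interior_injective_linear_image[OF linear_sign_act inj] .
  then show ?thesis using assms(2) by (metis image_eqI linear_0 linear_sign_act)
qed

lemma reflexive_polytope_sign_act:
  assumes "\<sigma> \<in> sign_vectors" "reflexive_polytope P"
  shows "reflexive_polytope (sign_act \<sigma> ` P)"
  using assms lattice_polytope_sign_act interior_sign_act
  by (auto simp: reflexive_polytope_def polar_dual_sign_act)

text \<open>Transports a statement about the orthant of \<open>\<sigma>\<close> to the nonnegative
  orthant, \<open>sign_act \<sigma>\<close> being an involution.\<close>

lemma Int_signed_orthant_eq_iff:
  assumes "\<sigma> \<in> sign_vectors"
  shows "P \<inter> signed_orthant \<sigma> = sign_act \<sigma> ` Q \<longleftrightarrow> sign_act \<sigma> ` P \<inter> nonneg_orthant = Q"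
proof -
  have inj: "inj (sign_act \<sigma>)" using sign_act_sign_act[OF assms] by (metis injI)
  have "P \<inter> signed_orthant \<sigma> = sign_act \<sigma> ` (sign_act \<sigma> ` P \<inter> nonneg_orthant)"
    unfolding signed_orthant_def image_Int[OF inj] sign_act_image_image[OF assms] by simp
  then show ?thesis using inj by (simp add: inj_image_eq_iff)
qed

lemma sign_vector_exists:
  fixes x :: "real ^ 'n"
  obtains \<sigma> where "\<sigma> \<in> sign_vectors" "sign_act \<sigma> x = (\<chi> i. \<bar>x $ i\<bar>)"
proof
  let ?s = "(\<chi> i. if 0 \<le> x $ i then 1 else -1) :: real ^ 'n"
  show "?s \<in> sign_vectors" by (auto simp: sign_vectors_def)
  show "sign_act ?s x = (\<chi> i. \<bar>x $ i\<bar>)" by (auto simp: vec_eq_iff)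
qed

lemma abs_vec_in_nonneg_orthant: "(\<chi> i. \<bar>x $ i\<bar>) \<in> nonneg_orthant"
  by (simp add: nonneg_orthant_def)

text \<open>After reflecting \<open>x\<close> to its vector of absolute values, zeroing coordinates
  only moves down; it also commutes with the reflection.\<close>

lemma locally_anti_blocking_imp_restriction_closed:
  assumes "locally_anti_blocking P"
  shows "restriction_closed P"
  unfolding restriction_closed_def
proof (intro allI ballI)
  fix J x assume x: "x \<in> P"
  obtain \<sigma> where \<sigma>: "\<sigma> \<in> sign_vectors" "sign_act \<sigma> x = (\<chi> i. \<bar>x $ i\<bar>)"
    by (rule sign_vector_exists)
  have "anti_blocking (sign_act \<sigma> ` P \<inter> nonneg_orthant)"
    using assms \<sigma>(1) by (simp add: locally_anti_blocking_def)
  moreover have "sign_act \<sigma> x \<in> sign_act \<sigma> ` P \<inter> nonneg_orthant"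
    using x abs_vec_in_nonneg_orthant[of x] by (simp add: \<sigma>(2)[symmetric])
  moreover have "\<forall>i. 0 \<le> coord_restrict J (sign_act \<sigma> x) $ i
      \<and> coord_restrict J (sign_act \<sigma> x) $ i \<le> sign_act \<sigma> x $ i"
    unfolding \<sigma>(2) by simp
  ultimately have "coord_restrict J (sign_act \<sigma> x) \<in> sign_act \<sigma> ` P \<inter> nonneg_orthant"
    unfolding anti_blocking_def by blast
  then show "coord_restrict J x \<in> P"
    using sign_act_image_iff[OF \<sigma>(1)] sign_act_sign_act[OF \<sigma>(1)]
    by (simp add: sign_act_coord_restrict)
qed

lemma unconditional_imp_restriction_closed:
  fixes P :: "(real ^ 'n) set"
  assumes "convex P" "unconditional P"
  shows "restriction_closed P"
  unfolding restriction_closed_def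
proof (intro allI ballI)
  fix J x assume x: "x \<in> P"
  \<comment> \<open>Reflecting the coordinates outside \<open>J\<close> and taking the midpoint with
    \<open>x\<close> zeroes exactly these coordinates.\<close>
  define \<sigma> :: "real ^ 'n" where "\<sigma> = (\<chi> i. if i \<in> J then 1 else -1)"
  have "\<sigma> \<in> sign_vectors" by (auto simp: \<sigma>_def sign_vectors_def)
  then have "sign_act \<sigma> x \<in> P" using assms(2) x unfolding unconditional_def by blast
  then have "(1/2) *\<^sub>R x + (1/2) *\<^sub>R sign_act \<sigma> x \<in> P"
    using x by (intro convexD[OF assms(1)]) auto
  moreover have "(1/2) *\<^sub>R x + (1/2) *\<^sub>R sign_act \<sigma> x = coord_restrict J x"
    by (auto simp: vec_eq_iff \<sigma>_def)
  ultimately show "coord_restrict J x \<in> P" by simp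
qed

section \<open>Polarity and lattice polytopes in the nonnegative orthant\<close>

lemma restriction_closed_polar_dual:
  "restriction_closed P \<Longrightarrow> restriction_closed (polar_dual P)"
  by (auto simp: restriction_closed_def polar_dual_def inner_coord_restrict)

text \<open>For nonnegative \<open>y\<close>, zeroing the negative coordinates of \<open>x\<close>
  stays in \<open>P\<close> and does not lower \<open>y \<bullet> x\<close>, so the constraints from
  nonnegative points imply all others.\<close>

lemma polar_dual_Int_nonneg_orthant:
  assumes "restriction_closed P"
  shows "polar_dual P \<inter> nonneg_orthant = anti_blocker (P \<inter> nonneg_orthant)"
proof -
  have "y \<bullet> x \<le> 1"
    if y: "y \<in> anti_blocker (P \<inter> nonneg_orthant)" and x: "x \<in> P" for x y
  proof -
    let ?x = "coord_restrict {i. 0 \<le> x $ i} x"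
    have "?x \<in> P \<inter> nonneg_orthant"
      using restriction_closedD[OF assms x] by (auto simp: nonneg_orthant_def)
    then have "y \<bullet> ?x \<le> 1" using y by (simp add: anti_blocker_def)
    moreover have "y \<bullet> x \<le> y \<bullet> ?x"
      unfolding inner_vec_def using y
      by (intro sum_mono) (auto simp: anti_blocker_def nonneg_orthant_def mult_nonneg_nonpos)
    ultimately show ?thesis by simp
  qed
  then show ?thesis by (auto simp: polar_dual_def anti_blocker_def)
qed

lemma restriction_closed_Int_nonneg_orthant:
  "restriction_closed P \<Longrightarrow> restriction_closed (P \<inter> nonneg_orthant)"
  by (auto simp: restriction_closed_def nonneg_orthant_def)

lemma coord_restrict_integer: "v \<in> integer_lattice \<Longrightarrow> coord_restrict J v \<in> integer_lattice"
  by (auto simp: integer_lattice_def)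

text \<open>Cutting with the orthant could create fractional vertices. It does not: the nonnegative
  restrictions of the generators span a downward closed hull, and every point of \<open>P\<close> is
  dominated by a point of that hull.\<close>

lemma lattice_polytope_Int_nonneg_orthant:
  assumes "lattice_polytope P" "restriction_closed P"
  shows "lattice_polytope (P \<inter> nonneg_orthant)"
proof -
  obtain V where V: "finite V" "V \<subseteq> integer_lattice" "P = convex hull V"
    using assms(1) by (auto simp: lattice_polytope_def)
  define W where "W = (\<Union>J. coord_restrict J ` V) \<inter> nonneg_orthant"
  have fin: "finite W" using V(1) by (simp add: W_def)
  have int: "W \<subseteq> integer_lattice" using V(2) coord_restrict_integer by (auto simp: W_def)
  have VP: "V \<subseteq> P" using V(3) by (simp add: hull_subset)
  have "W \<subseteq> P \<inter> nonneg_orthant"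
    using restriction_closedD[OF assms(2)] VP by (auto simp: W_def)
  moreover have conv: "convex (P \<inter> nonneg_orthant)"
    using V(3) by (simp add: convex_Int convex_nonneg_orthant)
  ultimately have sub: "convex hull W \<subseteq> P \<inter> nonneg_orthant" by (rule hull_minimal)
  have rW: "restriction_closed (convex hull W)"
  proof (rule restriction_closed_convex_hull)
    fix J w assume "w \<in> W"
    then obtain I v where v: "v \<in> V" "w = coord_restrict I v" "w \<in> nonneg_orthant"
      by (auto simp: W_def)
    have "coord_restrict J w = coord_restrict (J \<inter> I) v" by (auto simp: vec_eq_iff v(2))
    moreover have "coord_restrict J w \<in> nonneg_orthant" using v(3) by (auto simp: nonneg_orthant_def)
    ultimately show "coord_restrict J w \<in> W" using v(1) by (auto simp: W_def)
  qed
  have dom: "\<exists>q \<in> convex hull W. \<forall>i. x $ i \<le> q $ i" if "x \<in> convex hull V" for x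
  proof -
    \<comment> \<open>The dominated points form a convex set; it contains each generator, which lies
      below its own positive part.\<close>
    let ?D = "{x. \<exists>q \<in> convex hull W. \<forall>i. x $ i \<le> q $ i}"
    have "V \<subseteq> ?D"
    proof
      fix v assume v: "v \<in> V"
      let ?w = "coord_restrict {i. 0 \<le> v $ i} v"
      have "?w \<in> W" using v by (auto simp: W_def nonneg_orthant_def)
      then have "?w \<in> convex hull W" by (rule hull_inc)
      moreover have "\<forall>i. v $ i \<le> ?w $ i" by simp
      ultimately show "v \<in> ?D" by blast
    qed
    moreover have "convex ?D"
    proof (rule convexI)
      fix x y and u v :: real
      assume "x \<in> ?D" "y \<in> ?D" and uv: "0 \<le> u" "0 \<le> v" "u + v = 1"
      then obtain p q where pq: "p \<in> convex hull W" "q \<in> convex hull W"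
        "\<forall>i. x $ i \<le> p $ i" "\<forall>i. y $ i \<le> q $ i" by blast
      have "u *\<^sub>R p + v *\<^sub>R q \<in> convex hull W"
        using pq uv by (intro convexD convex_convex_hull)
      moreover have "\<forall>i. (u *\<^sub>R x + v *\<^sub>R y) $ i \<le> (u *\<^sub>R p + v *\<^sub>R q) $ i"
        using pq uv by (simp add: add_mono mult_left_mono)
      ultimately show "u *\<^sub>R x + v *\<^sub>R y \<in> ?D" by blast
    qed
    ultimately show ?thesis using that hull_minimal[of V ?D convex] by blast
  qed
  have "P \<inter> nonneg_orthant \<subseteq> convex hull W"
  proof
    fix x assume x: "x \<in> P \<inter> nonneg_orthant"
    then obtain q where q: "q \<in> convex hull W" "\<forall>i. x $ i \<le> q $ i" using dom V(3) by blast
    show "x \<in> convex hull W"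
      by (rule restriction_closed_down[OF convex_convex_hull rW q(1)])
        (use x q(2) in \<open>auto simp: nonneg_orthant_def\<close>)
  qed
  then show ?thesis using sub fin int unfolding lattice_polytope_def by blast
qed

section \<open>Characteristic vectors and hulls of set families\<close>

lemma char_vec_nth [simp]: "char_vec S $ i = (if i \<in> S then 1 else 0)"
  by (simp add: char_vec_def)

lemma inner_char_vec: "x \<bullet> char_vec S = (\<Sum>i\<in>S. x $ i)"
proof -
  have "x \<bullet> char_vec S = (\<Sum>i\<in>UNIV. if i \<in> S then x $ i else 0)"
    unfolding inner_vec_def by (rule sum.cong) auto
  then show ?thesis by (simp add: sum.If_cases)
qed

lemma inner_char_vec_char_vec: "char_vec S \<bullet> char_vec T = real (card (S \<inter> T))"
  by (simp add: inner_char_vec sum.If_cases Int_commute)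

lemma card_clique_Int_indep:
  fixes C S :: "'n::finite set"
  assumes "clique C E" "indep S E"
  shows "card (C \<inter> S) \<le> 1"
proof -
  have "\<forall>v\<in>C \<inter> S. \<forall>w\<in>C \<inter> S. v = w" using assms by (auto simp: clique_def indep_def)
  then show ?thesis by (simp add: card_le_Suc0_iff_eq)
qed

lemma stable_set_polytope_eq: "stable_set_polytope E = convex hull (char_vec ` {S. indep S E})"
  by (simp add: stable_set_polytope_def image_Collect)

lemma convex_hull_char_vec_nonneg: "convex hull (char_vec ` \<F>) \<subseteq> nonneg_orthant"
proof (rule hull_minimal)
  show "char_vec ` \<F> \<subseteq> nonneg_orthant" by (auto simp: nonneg_orthant_def)
qed (rule convex_nonneg_orthant)

lemma restriction_closed_convex_hull_char_vec:
  assumes "\<And>S T. S \<in> \<F> \<Longrightarrow> T \<subseteq> S \<Longrightarrow> T \<in> \<F>"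
  shows "restriction_closed (convex hull (char_vec ` \<F>))"
proof (rule restriction_closed_convex_hull)
  fix J w assume "w \<in> char_vec ` \<F>"
  then obtain S where S: "S \<in> \<F>" "w = char_vec S" by blast
  have "coord_restrict J w = char_vec (S \<inter> J)" by (simp add: vec_eq_iff S(2))
  then show "coord_restrict J w \<in> char_vec ` \<F>" using assms[OF S(1), of "S \<inter> J"] by auto
qed

lemma anti_blocker_anti_blocker_char_vec:
  fixes \<F> :: "'n::finite set set"
  assumes "\<And>S T. S \<in> \<F> \<Longrightarrow> T \<subseteq> S \<Longrightarrow> T \<in> \<F>" "{} \<in> \<F>"
  shows "anti_blocker (anti_blocker (convex hull (char_vec ` \<F>))) = convex hull (char_vec ` \<F>)"
proof (rule anti_blocker_anti_blocker)
  show "closed (convex hull (char_vec ` \<F>))"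
    by (intro compact_imp_closed finite_imp_compact_convex_hull) simp
  have "char_vec {} = (0 :: real ^ 'n)" by (simp add: vec_eq_iff)
  then show "0 \<in> convex hull (char_vec ` \<F>)" using assms(2) by (metis hull_inc image_eqI)
qed (simp_all add: convex_hull_char_vec_nonneg restriction_closed_convex_hull_char_vec assms(1))

lemma clique_subset: "clique C E \<Longrightarrow> D \<subseteq> C \<Longrightarrow> clique D E"
  by (auto simp: clique_def)

lemma indep_subset: "indep S E \<Longrightarrow> T \<subseteq> S \<Longrightarrow> indep T E"
  by (auto simp: indep_def)

lemma restriction_closed_stable_set_polytope: "restriction_closed (stable_set_polytope E)"
  unfolding stable_set_polytope_eq
  by (rule restriction_closed_convex_hull_char_vec) (auto intro: indep_subset)

section \<open>Clique number, colourings and perfection\<close>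

lemma card_le_clique_number:
  fixes W :: "'n::finite set"
  shows "C \<subseteq> W \<Longrightarrow> clique C E \<Longrightarrow> card C \<le> clique_number W E"
  unfolding clique_number_def by (rule Max_ge) auto

lemma clique_number_attained:
  fixes W :: "'n::finite set"
  obtains C where "C \<subseteq> W" "clique C E" "card C = clique_number W E"
proof -
  have "clique_number W E \<in> {card C |C. C \<subseteq> W \<and> clique C E}"
    unfolding clique_number_def
    \<comment> \<open>The empty clique keeps the set nonempty.\<close>
    by (rule Max_in) (auto intro!: exI[of _ "{}"] simp: clique_def)
  then show thesis using that by auto
qed

lemma simple_graph_no_loop: "simple_graph E \<Longrightarrow> {v, v} \<notin> E"
  by (auto simp: simple_graph_def dest!: bspec[of _ _ "{v}"])

lemma proper_colouring_mono: "proper_colouring W E k f \<Longrightarrow> k \<le> m \<Longrightarrow> proper_colouring W E m f"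
  by (auto simp: proper_colouring_def)

lemma chromatic_number_colouring:
  fixes E :: "'n::finite set set"
  assumes "simple_graph E"
  shows "\<exists>f. proper_colouring W E (chromatic_number W E) f"
proof -
  \<comment> \<open>Giving all vertices different colours is proper since there are no loops, so the
    \<open>LEAST\<close> is attained.\<close>
  obtain f :: "'n \<Rightarrow> nat" where f: "bij_betw f UNIV {..<CARD('n)}"
    using ex_bij_betw_finite_nat[of "UNIV :: 'n set"] by (auto simp: atLeast0LessThan)
  have "\<exists>f. proper_colouring W E CARD('n) f"
    using f simple_graph_no_loop[OF assms]
    by (intro exI[of _ f]) (auto simp: proper_colouring_def bij_betw_def inj_eq)
  then show ?thesis unfolding chromatic_number_def by (rule LeastI)
qed

lemma clique_card_le_colours:
  fixes C :: "'n::finite set"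
  assumes "proper_colouring W E k f" "C \<subseteq> W" "clique C E"
  shows "card C \<le> k"
proof -
  have "inj_on f C" using assms unfolding inj_on_def proper_colouring_def clique_def by blast
  moreover have "f ` C \<subseteq> {..<k}" using assms by (auto simp: proper_colouring_def)
  ultimately show ?thesis using card_inj_on_le[of f C "{..<k}"] by simp
qed

text \<open>With \<open>perfect_graphI\<close>, this turns perfection into a statement free of
  \<open>Max\<close> and \<open>LEAST\<close>: any bound on the cliques inside \<open>W\<close> is a
  sufficient number of colours.\<close>

lemma perfect_graph_colouring:
  assumes "perfect_graph E" "\<And>C. C \<subseteq> W \<Longrightarrow> clique C E \<Longrightarrow> card C \<le> N"
  shows "\<exists>f. proper_colouring W E N f"
proof -
  obtain C where "C \<subseteq> W" "clique C E" "card C = clique_number W E" by (rule clique_number_attained)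
  then have "chromatic_number W E \<le> N"
    using assms by (metis perfect_graph_def)
  then show ?thesis
    using chromatic_number_colouring[of E W] assms(1) proper_colouring_mono
    by (metis perfect_graph_def)
qed

text \<open>A clique needs distinct colours, so clique number at most chromatic number always holds;
  \<open>col\<close> at the clique number gives the reverse.\<close>

lemma perfect_graphI:
  assumes "simple_graph E"
    and col: "\<And>N W. (\<And>C. C \<subseteq> W \<Longrightarrow> clique C E \<Longrightarrow> card C \<le> N) \<Longrightarrow> \<exists>f. proper_colouring W E N f"
  shows "perfect_graph E"
  unfolding perfect_graph_def
proof (intro conjI allI order_antisym assms(1))
  fix W
  obtain C where C: "C \<subseteq> W" "clique C E" "card C = clique_number W E" by (rule clique_number_attained)
  obtain f where "proper_colouring W E (chromatic_number W E) f"
    using chromatic_number_colouring[OF assms(1)] by blast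
  then show "clique_number W E \<le> chromatic_number W E"
    using clique_card_le_colours C by metis
  have "\<exists>f. proper_colouring W E (clique_number W E) f"
    using col card_le_clique_number by blast
  then show "chromatic_number W E \<le> clique_number W E"
    unfolding chromatic_number_def by (rule Least_le)
qed

section \<open>Perfect graphs and anti-blocking polytopes\<close>

text \<open>Replication argument of Lovasz: if \<open>w v \<ge> 2\<close>, a colour class \<open>A\<close> through \<open>v\<close> of a colouring
  for the weight lowered at \<open>v\<close> meets every clique whose \<open>w\<close>-weight attains the bound \<open>N\<close>, so
  removing \<open>A\<close> lowers the bound.\<close>

lemma perfect_graph_weighted_colouring:
  fixes w :: "'n::finite \<Rightarrow> nat"
  assumes E: "perfect_graph E"
    and "\<And>C. clique C E \<Longrightarrow> sum w C \<le> N"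
  shows "\<exists>S. (\<forall>j<N. indep (S j) E) \<and> (\<forall>v. w v = card {j. j < N \<and> v \<in> S j})"
  using assms(2)
proof (induction "sum w UNIV" arbitrary: w N rule: less_induct)
  case less
  show ?case
  proof (cases "\<forall>v. w v \<le> 1")
    case True
    \<comment> \<open>For 0/1 weights the claim is an ordinary colouring of the support.\<close>
    define W where "W = {v. w v = 1}"
    have "card C \<le> N" if "C \<subseteq> W" "clique C E" for C
    proof -
      have "sum w C = card C" using that(1) by (simp add: W_def subset_iff)
      then show ?thesis using less.prems[OF that(2)] by simp
    qed
    then obtain f where f: "proper_colouring W E N f" using perfect_graph_colouring[OF E] by blast
    define S where "S j = {v \<in> W. f v = j}" for j
    have "indep (S j) E" for j using f unfolding S_def indep_def proper_colouring_def by blast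
    moreover have "w v = card {j. j < N \<and> v \<in> S j}" for v
    proof (cases "v \<in> W")
      case True
      then have "{j. j < N \<and> v \<in> S j} = {f v}" using f by (auto simp: S_def proper_colouring_def)
      then show ?thesis using True by (simp add: W_def)
    next
      case False
      then have "w v = 0" using \<open>\<forall>v. w v \<le> 1\<close>[rule_format, of v] by (simp add: W_def)
      then show ?thesis using False by (simp add: S_def)
    qed
    ultimately show ?thesis by blast
  next
    case False
    then obtain v where v: "w v \<ge> 2" by (metis Suc_1 not_less_eq_eq)
    define w' where "w' = w(v := w v - 1)"
    have w'_le: "w' u \<le> w u" for u by (simp add: w'_def)
    have "sum w' UNIV < sum w UNIV"
      using w'_le v by (intro sum_strict_mono_ex1) (auto simp: w'_def intro!: exI[of _ v])
    moreover have "sum w' C \<le> N" if "clique C E" for C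
      using less.prems[OF that] sum_mono[of C w' w] w'_le by (meson order_trans)
    ultimately obtain S where S: "\<And>j. j < N \<Longrightarrow> indep (S j) E"
      "\<And>u. w' u = card {j. j < N \<and> u \<in> S j}" using less.hyps[of w' N] by blast
    \<comment> \<open>Since \<open>w v \<ge> 2\<close>, weight at least 1 remains at
      \<open>v\<close>, so some class contains it.\<close>
    have "card {j. j < N \<and> v \<in> S j} > 0" using S(2)[of v] v by (simp add: w'_def)
    then obtain k where k: "k < N" "v \<in> S k" by (auto simp: card_gt_0_iff)
    define A where "A = S k"
    have A: "indep A E" "v \<in> A" using S(1) k by (auto simp: A_def)
    have wA: "w u \<ge> 1" if "u \<in> A" for u
    proof -
      have "k \<in> {j. j < N \<and> u \<in> S j}" using k that by (simp add: A_def)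
      then have "card {j. j < N \<and> u \<in> S j} > 0" by (auto simp: card_gt_0_iff)
      then show ?thesis using S(2)[of u] w'_le[of u] by simp
    qed
    \<comment> \<open>The truncated subtraction is exact because \<open>w\<close> is at least 1 on
      \<open>A\<close>.\<close>
    define w2 where "w2 u = w u - (if u \<in> A then 1 else 0)" for u
    have w2_le: "w2 u \<le> w u" for u by (simp add: w2_def)
    have less2: "sum w2 C < sum w C" if "u \<in> A" "u \<in> C" for u C
      using w2_le wA[OF that(1)] that
      by (intro sum_strict_mono_ex1) (auto simp: w2_def intro!: bexI[of _ u])
    have "sum w2 C \<le> N - 1" if C: "clique C E" for C
    proof (cases "sum w C \<le> N - 1")
      case True
      then show ?thesis using sum_mono[of C w2 w] w2_le by (meson order_trans)
    next
      case False
      then have wC: "sum w C = N" using less.prems[OF C] by simp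
      have "A \<inter> C \<noteq> {}"
      proof (cases "v \<in> C")
        case True
        then show ?thesis using A by blast
      next
        case vC: False
        show ?thesis
        proof
          assume dis: "A \<inter> C = {}"
          \<comment> \<open>Off \<open>v\<close> the weights agree, so the \<open>N\<close> classes
            cover \<open>C\<close> with total multiplicity \<open>N\<close>. Each meets
            \<open>C\<close> at most once, hence none may miss it, not even
            \<open>A = S k\<close>.\<close>
          have "N = sum w' C" unfolding wC[symmetric] using vC by (intro sum.cong) (auto simp: w'_def)
          also have "\<dots> = (\<Sum>u\<in>C. \<Sum>j<N. if u \<in> S j then 1 else 0)"
            unfolding S(2) by (intro sum.cong refl) (simp add: sum.If_cases lessThan_def Collect_conj_eq)
          also have "\<dots> = (\<Sum>j<N. \<Sum>u\<in>C. if u \<in> S j then 1 else 0)" by (rule sum.swap)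
          also have "\<dots> = (\<Sum>j<N. card (C \<inter> S j))" by (simp add: sum.If_cases)
          also have "\<dots> < (\<Sum>j<N. 1)"
          proof (rule sum_strict_mono_ex1)
            show "\<forall>j\<in>{..<N}. card (C \<inter> S j) \<le> 1" using card_clique_Int_indep[OF C] S(1) by simp
            show "\<exists>j\<in>{..<N}. card (C \<inter> S j) < 1"
              using k dis by (intro bexI[of _ k]) (auto simp: A_def Int_commute)
          qed simp
          finally show False by simp
        qed
      qed
      then show ?thesis using less2[of _ C] wC by fastforce
    qed
    then obtain T where T: "\<And>j. j < N - 1 \<Longrightarrow> indep (T j) E"
      "\<And>u. w2 u = card {j. j < N - 1 \<and> u \<in> T j}"
      using less.hyps[of w2 "N - 1"] less2[OF A(2)] by blast
    \<comment> \<open>The class \<open>A\<close> takes index \<open>N - 1\<close>;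
      \<open>k < N\<close> ensures \<open>N > 0\<close>, so this is the last index.\<close>
    define T' where "T' j = (if j < N - 1 then T j else A)" for j
    have "indep (T' j) E" for j using T(1) A(1) by (simp add: T'_def)
    moreover have "w u = card {j. j < N \<and> u \<in> T' j}" for u
    proof -
      have "{j. j < N \<and> u \<in> T' j} = {j. j < N - 1 \<and> u \<in> T j} \<union> (if u \<in> A then {N - 1} else {})"
        using k(1) by (auto simp: T'_def)
      moreover have "card \<dots> = w2 u + (if u \<in> A then 1 else 0)"
        unfolding T(2) by (subst card_Un_disjoint) auto
      ultimately show ?thesis using wA[of u] by (simp add: w2_def)
    qed
    ultimately show ?thesis by blast
  qed
qed

text \<open>Approximate a point by rational points obeying the clique inequalities. Clearing the
  denominator \<open>N\<close> gives integer weights with clique bound \<open>N\<close>, and the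
  weighted colouring then writes the point as an average of \<open>N\<close> stable sets.\<close>

lemma anti_blocker_cliques_subset_stable_set_polytope:
  fixes E :: "'n::finite set set"
  assumes E: "perfect_graph E"
  shows "anti_blocker (char_vec ` {C. clique C E}) \<subseteq> stable_set_polytope E"
proof
  fix x :: "real ^ 'n" assume x: "x \<in> anti_blocker (char_vec ` {C. clique C E})"
  have x0: "0 \<le> x $ i" for i using x by (simp add: anti_blocker_def nonneg_orthant_def)
  \<comment> \<open>Rounding down preserves the clique inequalities and costs at most
    \<open>1 / Suc n\<close> per coordinate; \<open>Suc n\<close> avoids the denominator 0.\<close>
  define y :: "nat \<Rightarrow> real ^ 'n" where
    "y n = (\<chi> i. real (nat \<lfloor>real (Suc n) * x $ i\<rfloor>) / real (Suc n))" for n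
  have "y n \<in> stable_set_polytope E" for n
  proof -
    define N where "N = Suc n"
    define w where "w i = nat \<lfloor>real N * x $ i\<rfloor>" for i
    have w_le: "real (w i) \<le> real N * x $ i" for i using x0[of i] by (simp add: w_def)
    have "sum w C \<le> N" if C: "clique C E" for C
    proof -
      have "real (sum w C) \<le> (\<Sum>i\<in>C. real N * x $ i)" using w_le by (simp add: sum_mono)
      also have "\<dots> = real N * (x \<bullet> char_vec C)" by (simp add: inner_char_vec sum_distrib_left)
      also have "\<dots> \<le> real N * 1" using x C by (intro mult_left_mono) (auto simp: anti_blocker_def)
      finally show ?thesis by (metis mult.right_neutral of_nat_le_iff)
    qed
    then obtain S where S: "\<And>j. j < N \<Longrightarrow> indep (S j) E" "\<And>v. w v = card {j. j < N \<and> v \<in> S j}"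
      using perfect_graph_weighted_colouring[OF E] by metis
    \<comment> \<open>Vertex \<open>i\<close> lies in \<open>w i\<close> of the \<open>N\<close>
      stable sets, so coordinate \<open>i\<close> of their average is
      \<open>w i / N\<close>.\<close>
    have "(\<Sum>j<N. (1 / real N) *\<^sub>R char_vec (S j)) \<in> stable_set_polytope E"
      unfolding stable_set_polytope_eq
      by (rule convex_sum) (use S(1) in \<open>auto simp: N_def intro!: hull_inc\<close>)
    moreover have "(\<Sum>j<N. (1 / real N) *\<^sub>R char_vec (S j)) = y n"
    proof -
      have "(\<Sum>j<N. (1 / real N) *\<^sub>R char_vec (S j)) $ i = real (w i) / real N" for i
      proof -
        have "(\<Sum>j<N. (1 / real N) *\<^sub>R char_vec (S j)) $ i
            = (1 / real N) * (\<Sum>j<N. if i \<in> S j then 1 else 0)"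
          by (simp add: sum_distrib_left)
        also have "(\<Sum>j<N. if i \<in> S j then 1 else 0) = real (w i)"
          unfolding S(2) by (simp add: sum.If_cases lessThan_def Collect_conj_eq)
        finally show ?thesis by simp
      qed
      then show ?thesis by (simp add: vec_eq_iff y_def w_def N_def)
    qed
    ultimately show ?thesis by simp
  qed
  moreover have "y \<longlonglongrightarrow> x"
  proof (rule vec_tendstoI)
    fix i
    have "(\<lambda>n. y n $ i - x $ i) \<longlonglongrightarrow> 0"
    proof (rule Lim_null_comparison[OF always_eventually LIMSEQ_inverse_real_of_nat], rule allI)
      fix n
      define t where "t = real (Suc n) * x $ i"
      have "0 \<le> t" using x0 by (simp add: t_def)
      then have "\<bar>real (nat \<lfloor>t\<rfloor>) - t\<bar> \<le> 1" by linarith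
      moreover have "y n $ i - x $ i = (real (nat \<lfloor>t\<rfloor>) - t) / real (Suc n)"
        unfolding y_def t_def by (simp add: field_simps del: of_nat_Suc)
      ultimately show "norm (y n $ i - x $ i) \<le> inverse (real (Suc n))"
        by (simp add: divide_simps del: of_nat_Suc)
    qed
    then show "(\<lambda>n. y n $ i) \<longlonglongrightarrow> x $ i" by (rule LIM_zero_cancel)
  qed
  moreover have "closed (stable_set_polytope E)"
    unfolding stable_set_polytope_eq
    by (intro compact_imp_closed finite_imp_compact_convex_hull) simp
  ultimately show "x \<in> stable_set_polytope E" using closed_sequentially by blast
qed

text \<open>A clique and a stable set share at most one vertex; with the preceding inclusion the
  stable set polytope is the anti-blocker of the clique hull, and double duality turns this around.
  It exhibits lattice generators for the dual side.\<close>

lemma anti_blocker_stable_set_polytope: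
  assumes "perfect_graph E"
  shows "anti_blocker (stable_set_polytope E) = convex hull (char_vec ` {C. clique C E})"
proof -
  let ?K = "convex hull (char_vec ` {C. clique C E})"
  have "anti_blocker ?K = stable_set_polytope E"
  proof
    show "anti_blocker ?K \<subseteq> stable_set_polytope E"
      unfolding anti_blocker_convex_hull
      by (rule anti_blocker_cliques_subset_stable_set_polytope[OF assms])
    have "char_vec ` {S. indep S E} \<subseteq> anti_blocker ?K"
      unfolding anti_blocker_convex_hull
      by (auto simp: anti_blocker_def nonneg_orthant_def inner_char_vec_char_vec Int_commute
          dest: card_clique_Int_indep)
    moreover have "convex (anti_blocker ?K)"
    proof -
      have "anti_blocker ?K = nonneg_orthant \<inter> (\<Inter>x\<in>?K. {y. x \<bullet> y \<le> 1})"
        by (auto simp: anti_blocker_def inner_commute)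
      then show ?thesis by (simp add: convex_Int convex_nonneg_orthant convex_INT convex_halfspace_le)
    qed
    ultimately show "stable_set_polytope E \<subseteq> anti_blocker ?K"
      unfolding stable_set_polytope_eq by (rule hull_minimal)
  qed
  moreover have "anti_blocker (anti_blocker ?K) = ?K"
    by (rule anti_blocker_anti_blocker_char_vec) (auto intro: clique_subset simp: clique_def)
  ultimately show ?thesis by simp
qed

text \<open>If all cliques inside \<open>W\<close> have at most \<open>N\<close> vertices, then \<open>\<one>\<^sub>W / N\<close> is a convex combination of
  stable sets, and each stable set occurring in it meets every clique of size \<open>N\<close> in \<open>W\<close>.\<close>

lemma perfect_graph_if_anti_blocker_subset:
  fixes E :: "'n::finite set set"
  assumes "simple_graph E"
    and sub: "anti_blocker (char_vec ` {C. clique C E}) \<subseteq> stable_set_polytope E"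
  shows "perfect_graph E"
proof (rule perfect_graphI[OF assms(1)])
  fix N W assume "\<And>C. C \<subseteq> W \<Longrightarrow> clique C E \<Longrightarrow> card C \<le> N"
  then show "\<exists>f. proper_colouring W E N f"
  proof (induction N arbitrary: W)
    case 0
    have "W = {}"
    proof (rule ccontr)
      assume "W \<noteq> {}"
      then obtain v where "v \<in> W" by blast
      then show False using 0[of "{v}"] by (simp add: clique_def)
    qed
    then show ?case by (simp add: proper_colouring_def)
  next
    case (Suc M)
    define F :: "(real ^ 'n) set" where "F = char_vec ` {S. indep S E}"
    have finF: "finite F" by (simp add: F_def)
    let ?x = "(1 / real (Suc M)) *\<^sub>R char_vec W :: real ^ 'n"
    have "?x \<in> anti_blocker (char_vec ` {C. clique C E})"
      unfolding anti_blocker_def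
    proof (intro CollectI conjI ballI)
      show "?x \<in> nonneg_orthant" by (simp add: nonneg_orthant_def)
      fix c :: "real ^ 'n" assume "c \<in> char_vec ` {C. clique C E}"
      then obtain C where C: "clique C E" "c = char_vec C" by blast
      have "card (W \<inter> C) \<le> Suc M" using Suc.prems[of "W \<inter> C"] clique_subset[OF C(1)] by simp
      then have "real (card (W \<inter> C)) \<le> real (Suc M)" using of_nat_le_iff by blast
      then show "?x \<bullet> c \<le> 1" by (simp add: C(2) inner_char_vec_char_vec divide_simps del: of_nat_Suc)
    qed
    then have "?x \<in> convex hull F" using sub by (auto simp: stable_set_polytope_eq F_def)
    then obtain u where u: "\<forall>s\<in>F. 0 \<le> u s" "sum u F = 1" "(\<Sum>s\<in>F. u s *\<^sub>R s) = ?x"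
      by (auto simp: convex_hull_finite[OF finF])
    have "\<exists>s\<in>F. u s \<noteq> 0"
    proof (rule ccontr)
      assume "\<not> ?thesis"
      then show False using u(2) by simp
    qed
    then obtain S where S: "indep S E" "u (char_vec S) \<noteq> 0" by (auto simp: F_def)
    have hit: "S \<inter> C \<noteq> {}" if C: "C \<subseteq> W" "clique C E" "card C = Suc M" for C
    proof
      assume dis: "S \<inter> C = {}"
      have le: "s \<bullet> char_vec C \<le> 1" if "s \<in> F" for s
        using that card_clique_Int_indep[OF C(2)]
        by (auto simp: F_def inner_char_vec_char_vec Int_commute)
      \<comment> \<open>The value 1 is a weighted average of the numbers
        \<open>s \<bullet> char_vec C\<close>, none above 1, so each one with nonzero weight equals
        1.\<close>
      have "1 = ?x \<bullet> char_vec C"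
        using C by (simp add: inner_char_vec_char_vec Int_absorb1)
      also have "\<dots> = (\<Sum>s\<in>F. u s * (s \<bullet> char_vec C))"
        unfolding u(3)[symmetric] by (simp add: inner_sum_left)
      finally have "(\<Sum>s\<in>F. u s * (1 - s \<bullet> char_vec C)) = 0"
        using u(2) by (simp add: right_diff_distrib sum_subtractf)
      moreover have "\<forall>s\<in>F. 0 \<le> u s * (1 - s \<bullet> char_vec C)" using u(1) le by simp
      ultimately have "\<forall>s\<in>F. u s * (1 - s \<bullet> char_vec C) = 0"
        using finF by (simp add: sum_nonneg_eq_0_iff)
      moreover have "char_vec S \<in> F" using S(1) by (simp add: F_def)
      ultimately have "char_vec S \<bullet> char_vec C = 1" using S(2) by auto
      then show False using dis by (simp add: inner_char_vec_char_vec)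
    qed
    \<comment> \<open>Deleting \<open>S\<close> destroys every clique of size \<open>Suc M\<close>;
      the induction colours the rest with \<open>M\<close> colours and \<open>S\<close> receives the
      new colour \<open>M\<close>.\<close>
    have "card C \<le> M" if C: "C \<subseteq> W - S" "clique C E" for C
      using Suc.prems[of C] hit[of C] C by (cases "card C = Suc M") (blast, fastforce)
    then obtain f where f: "proper_colouring (W - S) E M f" using Suc.IH by blast
    have "proper_colouring W E (Suc M) (\<lambda>v. if v \<in> S then M else f v)"
      unfolding proper_colouring_def
    proof (intro conjI ballI impI)
      show "(\<lambda>v. if v \<in> S then M else f v) ` W \<subseteq> {..<Suc M}"
        using f by (auto simp: proper_colouring_def less_Suc_eq)
      fix v w assume vw: "v \<in> W" "w \<in> W" "{v, w} \<in> E"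
      then have "v \<noteq> w" using simple_graph_no_loop[OF assms(1)] by auto
      then have "\<not> (v \<in> S \<and> w \<in> S)" using vw S(1) by (auto simp: indep_def)
      moreover have "f v < M" if "v \<in> W - S" for v using f that by (auto simp: proper_colouring_def)
      moreover have "f v \<noteq> f w" if "v \<notin> S" "w \<notin> S"
        using f that vw by (auto simp: proper_colouring_def)
      ultimately show "(if v \<in> S then M else f v) \<noteq> (if w \<in> S then M else f w)"
        using vw by (metis DiffI less_irrefl)
    qed
    then show ?case by blast
  qed
qed

section \<open>From reflexivity to perfect graphs\<close>

text \<open>Some generator has a positive coordinate \<open>i\<close>, at least 1 by integrality;
  the unit vector lies below it.\<close>

lemma axis_in_lattice_polytope:
  fixes Q :: "(real ^ 'n) set"
  assumes Q: "lattice_polytope Q" "Q \<subseteq> nonneg_orthant" "restriction_closed Q"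
    and x: "x \<in> Q" "0 < x $ i"
  shows "axis i 1 \<in> Q"
proof -
  obtain V where V: "finite V" "V \<subseteq> integer_lattice" "Q = convex hull V"
    using Q(1) by (auto simp: lattice_polytope_def)
  obtain v where v: "v \<in> V" "0 < v $ i"
  proof (rule ccontr)
    assume "\<not> thesis"
    then have "V \<subseteq> {x. x $ i \<le> 0}" using that by force
    moreover have "convex {x :: real ^ 'n. x $ i \<le> 0}"
      using convex_halfspace_le[of "axis i 1 :: real ^ 'n" 0] by (simp only: inner_axis' inner_real_def mult_1)
    ultimately have "Q \<subseteq> {x. x $ i \<le> 0}" unfolding V(3) by (rule hull_minimal)
    then show False using x by auto
  qed
  have vQ: "v \<in> Q" using v(1) V(3) by (simp add: hull_inc)
  obtain m where m: "v $ i = of_int m"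
    using v(1) V(2) unfolding integer_lattice_def by (blast elim: Ints_cases)
  then have "1 \<le> v $ i" using v(2) by simp
  moreover have "0 \<le> v $ j" for j using vQ Q(2) by (auto simp: nonneg_orthant_def)
  ultimately show ?thesis
    by (intro restriction_closed_down[OF lattice_polytope_convex[OF Q(1)] Q(3) vQ])
      (auto simp: axis_def)
qed

text \<open>Integer generators with coordinates between 0 and 1 are characteristic vectors.\<close>

lemma lattice_polytope_in_cube:
  fixes Q :: "(real ^ 'n) set"
  assumes "lattice_polytope Q" "Q \<subseteq> nonneg_orthant" "\<And>x i. x \<in> Q \<Longrightarrow> x $ i \<le> 1"
  shows "Q = convex hull (char_vec ` {S. char_vec S \<in> Q})"
proof
  obtain V where V: "finite V" "V \<subseteq> integer_lattice" "Q = convex hull V"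
    using assms(1) by (auto simp: lattice_polytope_def)
  show "convex hull (char_vec ` {S. char_vec S \<in> Q}) \<subseteq> Q"
    by (rule hull_minimal) (auto simp: lattice_polytope_convex assms(1))
  have "V \<subseteq> char_vec ` {S. char_vec S \<in> Q}"
  proof
    fix v assume v: "v \<in> V"
    then have vQ: "v \<in> Q" using V(3) by (simp add: hull_inc)
    have "v $ i = 0 \<or> v $ i = 1" for i
    proof -
      obtain m where m: "v $ i = of_int m"
        using v V(2) unfolding integer_lattice_def by (blast elim: Ints_cases)
      have "0 \<le> v $ i" "v $ i \<le> 1" using vQ assms(2,3) by (auto simp: nonneg_orthant_def)
      then have "0 \<le> m" "m \<le> 1" using m by auto
      then have "m = 0 \<or> m = 1" by linarith
      then show ?thesis using m by auto
    qed
    then have "v = char_vec {i. v $ i = 1}" by (auto simp: vec_eq_iff)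
    then show "v \<in> char_vec ` {S. char_vec S \<in> Q}" using vQ by (metis (mono_tags) image_eqI mem_Collect_eq)
  qed
  then show "Q \<subseteq> convex hull (char_vec ` {S. char_vec S \<in> Q})" unfolding V(3) by (rule hull_mono)
qed

text \<open>Treating one orthant suffices, because sign changes preserve both hypotheses.\<close>

lemma reflexive_Int_nonneg_orthant:
  fixes P :: "(real ^ 'n) set"
  assumes "reflexive_polytope P" "restriction_closed P"
  shows "\<exists>E. perfect_graph E \<and> P \<inter> nonneg_orthant = stable_set_polytope E"
proof -
  define Q where "Q = P \<inter> nonneg_orthant"
  define R where "R = anti_blocker Q"
  have P: "lattice_polytope P" "0 \<in> interior P" "lattice_polytope (polar_dual P)"
    using assms(1) by (auto simp: reflexive_polytope_def)
  have R_eq: "R = polar_dual P \<inter> nonneg_orthant"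
    using polar_dual_Int_nonneg_orthant[OF assms(2)] by (simp add: R_def Q_def)
  have Q: "lattice_polytope Q" "Q \<subseteq> nonneg_orthant" "restriction_closed Q"
    using lattice_polytope_Int_nonneg_orthant[OF P(1) assms(2)]
      restriction_closed_Int_nonneg_orthant[OF assms(2)] by (auto simp: Q_def)
  have R: "lattice_polytope R" "R \<subseteq> nonneg_orthant" "restriction_closed R"
    using lattice_polytope_Int_nonneg_orthant[OF P(3)] restriction_closed_polar_dual[OF assms(2)]
      restriction_closed_Int_nonneg_orthant by (auto simp: R_eq)
  have zero: "0 \<in> Q" using P(2) interior_subset by (auto simp: Q_def nonneg_orthant_def)
  have inner: "y \<bullet> x \<le> 1" if "x \<in> Q" "y \<in> R" for x y using that by (simp add: R_def anti_blocker_def)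
  have RQ: "anti_blocker R = Q"
    unfolding R_def using Q zero
    by (intro anti_blocker_anti_blocker)
      (auto intro: lattice_polytope_convex compact_imp_closed lattice_polytope_compact)
  \<comment> \<open>An interior origin puts a small multiple of the unit vector into
    \<open>Q\<close>.\<close>
  have axQ: "axis i 1 \<in> Q" for i
  proof -
    obtain e where e: "0 < e" "cball 0 e \<subseteq> P" using P(2) by (auto simp: mem_interior_cball)
    have "e *\<^sub>R axis i 1 \<in> (cball 0 e :: (real ^ 'n) set)" using e(1) by (simp add: norm_axis_1)
    then have "e *\<^sub>R axis i 1 \<in> Q" using e by (auto simp: Q_def nonneg_orthant_def axis_def)
    then show ?thesis using e(1) by (intro axis_in_lattice_polytope[OF Q]) (auto simp: axis_def)
  qed
  \<comment> \<open>Dually, boundedness of \<open>Q\<close> puts a small multiple of the unit vector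
    into \<open>R\<close>.\<close>
  have axR: "axis i 1 \<in> R" for i
  proof -
    obtain b where b: "0 < b" "\<And>x. x \<in> Q \<Longrightarrow> norm x \<le> b"
      using compact_imp_bounded[OF lattice_polytope_compact[OF Q(1)]] bounded_pos by metis
    have "axis i (1 / b) \<in> R"
      unfolding R_def anti_blocker_def
    proof (intro CollectI conjI ballI)
      show "axis i (1 / b) \<in> nonneg_orthant" using b(1) by (simp add: nonneg_orthant_def axis_def)
      fix x assume "x \<in> Q"
      then have "x $ i \<le> b" using b(2) component_le_norm_cart[of x i] by force
      then show "axis i (1 / b) \<bullet> x \<le> 1" using b(1) by (simp add: inner_axis')
    qed
    then show ?thesis using b(1) by (intro axis_in_lattice_polytope[OF R]) (auto simp: axis_def)
  qed
  \<comment> \<open>The unit vectors of \<open>R\<close> read as the inequalities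
    \<open>x $ i \<le> 1\<close> on \<open>Q\<close>, and conversely.\<close>
  have Qhull: "Q = convex hull (char_vec ` {S. char_vec S \<in> Q})"
    using inner[OF _ axR] by (intro lattice_polytope_in_cube Q) (simp add: inner_axis')
  have Rhull: "R = convex hull (char_vec ` {C. char_vec C \<in> R})"
    using inner[OF axQ] by (intro lattice_polytope_in_cube R) (simp add: inner_axis)
  define E where "E = {{i, j} |i j. i \<noteq> j \<and> char_vec {i, j} \<notin> Q}"
  have E_iff: "{i, j} \<in> E \<longleftrightarrow> i \<noteq> j \<and> char_vec {i, j} \<notin> Q" for i j
    by (auto simp: E_def doubleton_eq_iff insert_commute)
  have simple: "simple_graph E" by (auto simp: simple_graph_def E_def)
  have pair: "False" if "i \<noteq> j" "i \<in> C" "j \<in> C" "char_vec C \<in> R" "char_vec {i, j} \<in> Q" for i j C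
  proof -
    have "C \<inter> {i, j} = {i, j}" using that by auto
    then have "char_vec C \<bullet> char_vec {i, j} = 2" using that(1) by (simp add: inner_char_vec_char_vec)
    then show False using inner[OF that(5,4)] by simp
  qed
  have indep_iff: "char_vec S \<in> Q \<longleftrightarrow> indep S E" for S
  proof
    assume S: "char_vec S \<in> Q"
    show "indep S E"
      unfolding indep_def
    proof (intro ballI impI)
      fix i j assume ij: "i \<in> S" "j \<in> S" "i \<noteq> j"
      have "char_vec {i, j} = coord_restrict {i, j} (char_vec S)" using ij by (auto simp: vec_eq_iff)
      then have "char_vec {i, j} \<in> Q" using restriction_closedD[OF Q(3) S] by simp
      then show "{i, j} \<notin> E" by (simp add: E_iff)
    qed
  next
    assume S: "indep S E"
    \<comment> \<open>Pairwise compatibility suffices: a set of \<open>R\<close> meeting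
      \<open>S\<close> twice would pair to 2 with an edge vector of \<open>Q\<close>, so
      \<open>S\<close> satisfies every constraint from \<open>R\<close>.\<close>
    have "char_vec S \<in> anti_blocker (char_vec ` {C. char_vec C \<in> R})"
      unfolding anti_blocker_def
    proof (intro CollectI conjI ballI)
      show "char_vec S \<in> nonneg_orthant" by (simp add: nonneg_orthant_def)
      fix c :: "real ^ 'n" assume "c \<in> char_vec ` {C. char_vec C \<in> R}"
      then obtain C where C: "char_vec C \<in> R" "c = char_vec C" by blast
      have "\<forall>i\<in>S \<inter> C. \<forall>j\<in>S \<inter> C. i = j"
        using S pair[OF _ _ _ C(1)] by (auto simp: indep_def E_iff)
      then have "card (S \<inter> C) \<le> 1" by (simp add: card_le_Suc0_iff_eq)
      then show "char_vec S \<bullet> c \<le> 1" by (simp add: C(2) inner_char_vec_char_vec)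
    qed
    then show "char_vec S \<in> Q" using RQ Rhull anti_blocker_convex_hull by metis
  qed
  have QE: "Q = stable_set_polytope E" using Qhull by (simp add: stable_set_polytope_eq indep_iff)
  \<comment> \<open>All sets of \<open>R\<close> are cliques, so the clique inequalities include
    those that cut out \<open>Q\<close>.\<close>
  have "clique C E" if "char_vec C \<in> R" for C
    using pair[OF _ _ _ that] by (auto simp: clique_def E_iff)
  then have "anti_blocker (char_vec ` {C. clique C E}) \<subseteq> anti_blocker (char_vec ` {C. char_vec C \<in> R})"
    by (auto simp: anti_blocker_def)
  also have "\<dots> = Q" using RQ Rhull anti_blocker_convex_hull by metis
  finally have "perfect_graph E"
    using QE by (intro perfect_graph_if_anti_blocker_subset simple) simp
  then show ?thesis using QE by (auto simp: Q_def)
qed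

section \<open>From perfect graphs to reflexivity\<close>

lemma finite_sign_vectors: "finite (sign_vectors :: (real ^ 'n) set)"
proof (rule finite_subset)
  show "sign_vectors \<subseteq> range (\<lambda>S. (\<chi> i. if i \<in> S then 1 else -1) :: real ^ 'n)"
  proof
    fix \<sigma> :: "real ^ 'n" assume "\<sigma> \<in> sign_vectors"
    then have "\<sigma> = (\<chi> i. if i \<in> {i. \<sigma> $ i = 1} then 1 else -1)"
      by (auto simp: vec_eq_iff sign_vectors_def)
    then show "\<sigma> \<in> range (\<lambda>S. (\<chi> i. if i \<in> S then 1 else -1) :: real ^ 'n)" by blast
  qed
qed simp

lemma lattice_polytope_if_orthants:
  fixes K :: "(real ^ 'n) set"
  assumes "convex K"
    and orth: "\<And>\<sigma>. \<sigma> \<in> sign_vectors \<Longrightarrow>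
      \<exists>\<F>. sign_act \<sigma> ` K \<inter> nonneg_orthant = convex hull (char_vec ` \<F>)"
  shows "lattice_polytope K"
proof -
  \<comment> \<open>These are the points of \<open>K\<close> with all coordinates in
    \<open>{-1, 0, 1}\<close>; the generators of each orthant piece are among them.\<close>
  define V :: "(real ^ 'n) set" where
    "V = (\<Union>\<sigma>\<in>sign_vectors. sign_act \<sigma> ` range char_vec) \<inter> K"
  have "finite V" using finite_sign_vectors unfolding V_def by (intro finite_Int) auto
  moreover have "V \<subseteq> integer_lattice"
    unfolding V_def by (auto intro!: sign_act_integer) (auto simp: integer_lattice_def)
  moreover have "convex hull V \<subseteq> K" by (rule hull_minimal) (auto simp: V_def assms(1))
  moreover have "K \<subseteq> convex hull V"
  proof
    fix x assume x: "x \<in> K"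
    obtain \<sigma> where \<sigma>: "\<sigma> \<in> sign_vectors" "sign_act \<sigma> x = (\<chi> i. \<bar>x $ i\<bar>)"
      by (rule sign_vector_exists)
    obtain \<F> where F: "sign_act \<sigma> ` K \<inter> nonneg_orthant = convex hull (char_vec ` \<F>)"
      using orth[OF \<sigma>(1)] by blast
    have "sign_act \<sigma> x \<in> convex hull (char_vec ` \<F>)"
      using x abs_vec_in_nonneg_orthant[of x] by (simp add: F[symmetric] \<sigma>(2)[symmetric])
    then have "x \<in> sign_act \<sigma> ` (convex hull (char_vec ` \<F>))"
      by (simp add: sign_act_image_iff[OF \<sigma>(1)])
    then have "x \<in> convex hull (sign_act \<sigma> ` char_vec ` \<F>)"
      by (simp add: convex_hull_linear_image[OF linear_sign_act])
    moreover have "sign_act \<sigma> ` char_vec ` \<F> \<subseteq> V"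
    proof -
      have "char_vec ` \<F> \<subseteq> sign_act \<sigma> ` K" using F hull_subset[of "char_vec ` \<F>" convex] by blast
      then have "sign_act \<sigma> ` char_vec ` \<F> \<subseteq> K"
        using sign_act_image_image[OF \<sigma>(1)] by (metis image_mono)
      then show ?thesis using \<sigma>(1) by (auto simp: V_def)
    qed
    ultimately show "x \<in> convex hull V" using hull_mono by blast
  qed
  ultimately show ?thesis unfolding lattice_polytope_def by blast
qed

text \<open>In each orthant the polar is a reflected anti-blocker of a stable set polytope, hence
  spanned by signed clique vectors.\<close>

lemma lattice_polytope_polar_dual:
  fixes P :: "(real ^ 'n) set"
  assumes "restriction_closed P"
    and orth: "\<And>\<sigma>. \<sigma> \<in> sign_vectors \<Longrightarrow>
      \<exists>G. perfect_graph G \<and> sign_act \<sigma> ` P \<inter> nonneg_orthant = stable_set_polytope G"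
  shows "lattice_polytope (polar_dual P)"
proof (rule lattice_polytope_if_orthants)
  have "polar_dual P = (\<Inter>x\<in>P. {y. x \<bullet> y \<le> 1})" by (auto simp: polar_dual_def inner_commute)
  then show "convex (polar_dual P)" by (simp add: convex_INT convex_halfspace_le)
  fix \<sigma> :: "real ^ 'n" assume \<sigma>: "\<sigma> \<in> sign_vectors"
  obtain G where G: "perfect_graph G" "sign_act \<sigma> ` P \<inter> nonneg_orthant = stable_set_polytope G"
    using orth[OF \<sigma>] by blast
  have "sign_act \<sigma> ` polar_dual P \<inter> nonneg_orthant = anti_blocker (sign_act \<sigma> ` P \<inter> nonneg_orthant)"
    using polar_dual_Int_nonneg_orthant[OF restriction_closed_sign_act[OF assms(1), of \<sigma>]]
    by (simp add: polar_dual_sign_act[OF \<sigma>])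
  also have "\<dots> = convex hull (char_vec ` {C. clique C G})"
    by (simp add: G anti_blocker_stable_set_polytope)
  finally show "\<exists>\<F>. sign_act \<sigma> ` polar_dual P \<inter> nonneg_orthant = convex hull (char_vec ` \<F>)"
    by blast
qed

text \<open>Stated for restriction-closed \<open>P\<close>, so that it serves locally anti-blocking
  and unconditional polytopes alike.\<close>

lemma reflexive_polytope_iff_perfect_graphs:
  fixes P :: "(real ^ 'n) set"
  assumes "restriction_closed P" "lattice_polytope P" "0 \<in> interior P"
  shows "reflexive_polytope P \<longleftrightarrow>
    (\<forall>\<sigma>\<in>sign_vectors. \<exists>G. perfect_graph G \<and> sign_act \<sigma> ` P \<inter> nonneg_orthant = stable_set_polytope G)"
proof
  assume P: "reflexive_polytope P"
  show "\<forall>\<sigma>\<in>sign_vectors. \<exists>G. perfect_graph G \<and> sign_act \<sigma> ` P \<inter> nonneg_orthant = stable_set_polytope G"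
    using reflexive_Int_nonneg_orthant reflexive_polytope_sign_act[OF _ P]
      restriction_closed_sign_act[OF assms(1)] by blast
next
  assume "\<forall>\<sigma>\<in>sign_vectors. \<exists>G. perfect_graph G \<and> sign_act \<sigma> ` P \<inter> nonneg_orthant = stable_set_polytope G"
  then show "reflexive_polytope P"
    using lattice_polytope_polar_dual[OF assms(1)] assms(2,3) by (simp add: reflexive_polytope_def)
qed

section \<open>Unconditional polytopes\<close>

lemma abs_sign_act:
  assumes "\<sigma> \<in> sign_vectors"
  shows "(\<chi> i. \<bar>sign_act \<sigma> x $ i\<bar>) = (\<chi> i. \<bar>x $ i\<bar>)"
proof -
  have "\<bar>\<sigma> $ i\<bar> = 1" for i using assms by (auto simp: sign_vectors_def dest: spec[of _ i])
  then show ?thesis by (simp add: vec_eq_iff abs_mult)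
qed

lemma unconditional_unconditional_hull:
  fixes Q :: "(real ^ 'n) set"
  shows "unconditional (unconditional_hull Q)"
  unfolding unconditional_def
proof
  fix \<sigma> :: "real ^ 'n" assume \<sigma>: "\<sigma> \<in> sign_vectors"
  show "sign_act \<sigma> ` unconditional_hull Q = unconditional_hull Q"
    using abs_sign_act[OF \<sigma>] by (auto simp: sign_act_image_iff[OF \<sigma>] unconditional_hull_def)
qed

text \<open>A point and its vector of absolute values differ by a sign change.\<close>

lemma unconditional_eq_unconditional_hull:
  assumes "unconditional P"
  shows "P = unconditional_hull (P \<inter> nonneg_orthant)"
proof -
  have "x \<in> P \<longleftrightarrow> (\<chi> i. \<bar>x $ i\<bar>) \<in> P" for x
  proof -
    obtain \<sigma> where \<sigma>: "\<sigma> \<in> sign_vectors" "sign_act \<sigma> x = (\<chi> i. \<bar>x $ i\<bar>)"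
      by (rule sign_vector_exists)
    have "sign_act \<sigma> ` P = P" using assms \<sigma>(1) by (simp add: unconditional_def)
    then show ?thesis using sign_act_image_iff[OF \<sigma>(1), of x P] \<sigma>(2) by simp
  qed
  then show ?thesis using abs_vec_in_nonneg_orthant by (auto simp: unconditional_hull_def)
qed

lemma unconditional_hull_Int_nonneg_orthant:
  assumes "Q \<subseteq> nonneg_orthant"
  shows "unconditional_hull Q \<inter> nonneg_orthant = Q"
proof -
  have "(\<chi> i. \<bar>x $ i\<bar>) = x" if "x \<in> nonneg_orthant" for x
    using that by (simp add: nonneg_orthant_def vec_eq_iff)
  then show ?thesis using assms by (auto simp: unconditional_hull_def)
qed

text \<open>By the triangle inequality the absolute values of a convex combination lie below the
  combination of absolute values; \<open>Q\<close> is closed downwards.\<close>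

lemma convex_unconditional_hull:
  assumes "convex Q" "restriction_closed Q"
  shows "convex (unconditional_hull Q)"
proof (rule convexI)
  fix x y and u v :: real
  assume xy: "x \<in> unconditional_hull Q" "y \<in> unconditional_hull Q" and uv: "0 \<le> u" "0 \<le> v" "u + v = 1"
  have "u *\<^sub>R (\<chi> i. \<bar>x $ i\<bar>) + v *\<^sub>R (\<chi> i. \<bar>y $ i\<bar>) \<in> Q"
    using xy uv by (intro convexD[OF assms(1)]) (auto simp: unconditional_hull_def)
  moreover have "\<bar>u * x $ i + v * y $ i\<bar> \<le> u * \<bar>x $ i\<bar> + v * \<bar>y $ i\<bar>" for i
    using uv abs_triangle_ineq[of "u * x $ i" "v * y $ i"] by (simp add: abs_mult)
  ultimately have "(\<chi> i. \<bar>(u *\<^sub>R x + v *\<^sub>R y) $ i\<bar>) \<in> Q"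
    by (elim restriction_closed_down[OF assms]) auto
  then show "u *\<^sub>R x + v *\<^sub>R y \<in> unconditional_hull Q" by (simp add: unconditional_hull_def)
qed

lemma zero_in_interior_unconditional_hull:
  fixes E :: "'n::finite set set"
  shows "0 \<in> interior (unconditional_hull (stable_set_polytope E))"
proof -
  let ?d = "real CARD('n)"
  have d: "0 < ?d" by simp
  \<comment> \<open>Singletons are stable in any graph; the average of their vectors dominates the
    absolute values of the ball of radius \<open>1 / ?d\<close>.\<close>
  have "(\<Sum>i\<in>UNIV. (1 / ?d) *\<^sub>R char_vec {i}) \<in> stable_set_polytope E"
    unfolding stable_set_polytope_eq
    by (rule convex_sum) (auto simp: indep_def intro!: hull_inc)
  moreover have "(\<Sum>i\<in>UNIV. (1 / ?d) *\<^sub>R char_vec {i}) = (\<chi> i :: 'n. 1 / ?d)"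
    by (simp add: vec_eq_iff if_distrib[of "\<lambda>t. t / _"] cong: if_cong)
  ultimately have q: "(\<chi> i. 1 / ?d) \<in> stable_set_polytope E" by simp
  have conv: "convex (stable_set_polytope E)" by (simp add: stable_set_polytope_eq)
  have "ball 0 (1 / ?d) \<subseteq> unconditional_hull (stable_set_polytope E)"
  proof
    fix x :: "real ^ 'n" assume "x \<in> ball 0 (1 / ?d)"
    then have "\<bar>x $ i\<bar> \<le> 1 / ?d" for i using component_le_norm_cart[of x i] by simp
    then have "(\<chi> i. \<bar>x $ i\<bar>) \<in> stable_set_polytope E"
      by (intro restriction_closed_down[OF conv restriction_closed_stable_set_polytope q]) auto
    then show "x \<in> unconditional_hull (stable_set_polytope E)" by (simp add: unconditional_hull_def)
  qed
  then show ?thesis using d by (auto simp: mem_interior intro!: exI[of _ "1 / ?d"])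
qed

text \<open>Forwards, one orthant piece determines \<open>P\<close>. Backwards, all reflected pieces
  coincide, so a single graph serves every \<open>\<sigma>\<close>.\<close>

lemma unconditional_reflexive_iff:
  fixes P :: "(real ^ 'n) set"
  shows "unconditional P \<and> reflexive_polytope P \<longleftrightarrow>
    (\<exists>G. perfect_graph G \<and> P = unconditional_hull (stable_set_polytope G))"
proof
  assume P: "unconditional P \<and> reflexive_polytope P"
  then have "restriction_closed P"
    by (intro unconditional_imp_restriction_closed)
      (auto simp: reflexive_polytope_def lattice_polytope_convex)
  then show "\<exists>G. perfect_graph G \<and> P = unconditional_hull (stable_set_polytope G)"
    using reflexive_Int_nonneg_orthant[of P] unconditional_eq_unconditional_hull[of P] P by metis
next
  assume "\<exists>G. perfect_graph G \<and> P = unconditional_hull (stable_set_polytope G)"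
  then obtain G where G: "perfect_graph G" "P = unconditional_hull (stable_set_polytope G)" by blast
  have unc: "unconditional P" by (simp add: G(2) unconditional_unconditional_hull)
  have conv: "convex P"
    unfolding G(2) by (rule convex_unconditional_hull[OF _ restriction_closed_stable_set_polytope])
      (simp add: stable_set_polytope_eq)
  have rc: "restriction_closed P" by (rule unconditional_imp_restriction_closed[OF conv unc])
  have orth: "sign_act \<sigma> ` P \<inter> nonneg_orthant = stable_set_polytope G" if "\<sigma> \<in> sign_vectors" for \<sigma>
  proof -
    have "sign_act \<sigma> ` P = P" using unc that by (simp add: unconditional_def)
    then show ?thesis
      by (simp add: G(2) unconditional_hull_Int_nonneg_orthant stable_set_polytope_eq
          convex_hull_char_vec_nonneg)
  qed
  have "lattice_polytope P"
    using orth stable_set_polytope_eq by (intro lattice_polytope_if_orthants[OF conv]) blast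
  then have "reflexive_polytope P"
    using reflexive_polytope_iff_perfect_graphs[OF rc] orth G(1)
      zero_in_interior_unconditional_hull[of G] by (auto simp: G(2)[symmetric])
  then show "unconditional P \<and> reflexive_polytope P" using unc by simp
qed

theorem theorem4p6:
  fixes P :: "(real ^ 'n) set"
  shows "(locally_anti_blocking P \<and> lattice_polytope P \<and> 0 \<in> interior P \<longrightarrow>
           (reflexive_polytope P \<longleftrightarrow>
             (\<forall>\<sigma> \<in> sign_vectors. \<exists>G :: 'n set set. perfect_graph G \<and>
                P \<inter> signed_orthant \<sigma> = sign_act \<sigma> ` stable_set_polytope G)))
       \<and> (unconditional P \<and> reflexive_polytope P \<longleftrightarrow>
           (\<exists>G :: 'n set set. perfect_graph G \<and> P = unconditional_hull (stable_set_polytope G)))"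
  using reflexive_polytope_iff_perfect_graphs[OF locally_anti_blocking_imp_restriction_closed, of P]
    unconditional_reflexive_iff[of P]
  by (simp add: Int_signed_orthant_eq_iff)

end
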